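(* Let $A\in\mathbb{R}^{m\times n}$, $b\in\mathbb{R}^m$, $0<\varrho<\|b\|$. Let $p:\mathbb{R}^n\to(-\infty,+\infty]$ be a polyhedral gauge function and let $\lambda^*$ be the solution to $\varphi(\lambda)=\varrho$. Assume that $0<\lambda_\infty<+\infty$. If the Clarke generalized Jacobian $\partial\varphi(\lambda^* )$ is a singleton, the sequence $\{\lambda_k\}$ generated by the secant method (described in the context) for solving $\varphi(\lambda)=\varrho$ converges to $\lambda^*$ Q-superlinearly with Q-order at least $(1+\sqrt5)/2$.
   Context: A gauge function is a nonnegative, positively homogeneous convex function $p$ with $p(0)=0$; $p$ is proper and closed; polyhedral means its epigraph is polyhedral. $\lambda_\infty:=\inf\{\nu\ge0\mid A^Tb\in\nu\,\partial p(0)\}$, where $\partial p(0)$ is the subdifferential of $p$ at the origin. For $\lambda>0$ let $\Omega(\lambda)$ be the solution set of $\min_{x\in\mathbb{R}^n}\{\tfrac12\|Ax-b\|^2+\lambda p(x)\}$. Standing assumptions: the problem $\min_x\{p(x)\mid\|Ax-b\|\le\varrho\}$ admits active solutions; for every $\lambda>0$ there is $(y,u,x)$ with $x\in\partial p^*(u)$, $y-b+Ax=0$, $A^Ty-\lambda u=0$ ($p^*$ the Fenchel conjugate of $p$), so that $\Omega(\lambda)\ne\emptyset$ and $b-Ax(\lambda)$ is the same for all $x(\lambda)\in\Omega(\lambda)$; and $\varphi(\lambda)=\varrho$ has at least one solution $\lambda^*>0$. Here $\varphi(\lambda):=\|Ax(\lambda)-b\|$ with $x(\lambda)\in\Omega(\lambda)$.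 Secant method: the input is two generic starting points $\lambda_{-1},\lambda_0$; set $k=0$; while $\varphi(\lambda_k)\ne\varrho$, compute $$\lambda_{k+1}=\lambda_k-\Big(\frac{\varphi(\lambda_k)-\varphi(\lambda_{k-1})}{\lambda_k-\lambda_{k-1}}\Big)^{-1}(\varphi(\lambda_k)-\varrho)$$ and set $k=k+1$. The Clarke generalized Jacobian $\partial\varphi(\lambda)$ is the convex hull of all limits of $\varphi'(\lambda_j)$ along sequences $\lambda_j\to\lambda$ of points where $\varphi$ is differentiable. With $e_k=\lambda_k-\lambda^*$: Q-superlinear convergence means $|e_{k+1}|=o(|e_k|)$; Q-order at least $\tau>1$ means $\lim_{k\to\infty}|e_{k+1}|/|e_k|^q=0$ for every $q\in[1,\tau)$.
   Formalization: The two starting points are taken distinct and sufficiently close to λ* (local convergence); for arbitrary or generic starting points the claim fails, e.g. φ(λ)=min(λ,1), ϱ=1/2, starting points 2 and 3. *)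

theory Defs
  imports "HOL-Analysis.Analysis" "HOL-Library.Landau_Symbols"
begin

text \<open>Extended-real-valued convex functions. The library's \<^const>\<open>epigraph\<close>, \<^const>\<open>convex_on\<close>
  are restricted to real-valued functions, so the notions for functions into
  the extended reals are phrased via the epigraph in \<open>'a \<times> real\<close>.\<close>

definition epi :: "('a \<Rightarrow> ereal) \<Rightarrow> ('a \<times> real) set" where
  "epi f = {(x, t). f x \<le> ereal t}"

definition proper_fun :: "('a \<Rightarrow> ereal) \<Rightarrow> bool" where
  "proper_fun f \<longleftrightarrow> (\<forall>x. f x \<noteq> -\<infinity>) \<and> (\<exists>x. f x \<noteq> \<infinity>)"

definition closed_fun :: "('a::topological_space \<Rightarrow> ereal) \<Rightarrow> bool" where
  "closed_fun f \<longleftrightarrow> closed (epi f)"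

definition convex_fun :: "('a::real_vector \<Rightarrow> ereal) \<Rightarrow> bool" where
  "convex_fun f \<longleftrightarrow> convex (epi f)"

definition polyhedral_fun :: "('a::euclidean_space \<Rightarrow> ereal) \<Rightarrow> bool" where
  "polyhedral_fun f \<longleftrightarrow> polyhedron (epi f)"

definition gauge_fun :: "('a::real_vector \<Rightarrow> ereal) \<Rightarrow> bool" where
  "gauge_fun f \<longleftrightarrow>
     (\<forall>x. 0 \<le> f x) \<and> (\<forall>t>0. \<forall>x. f (t *\<^sub>R x) = ereal t * f x) \<and> convex_fun f \<and> f 0 = 0"

definition subdifferential :: "('a::real_inner \<Rightarrow> ereal) \<Rightarrow> 'a \<Rightarrow> 'a set" where
  "subdifferential f x = {v. \<forall>z. f x + ereal (v \<bullet> (z - x)) \<le> f z}"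

definition conjugate :: "('a::real_inner \<Rightarrow> ereal) \<Rightarrow> 'a \<Rightarrow> ereal" where
  "conjugate f u = (SUP x. ereal (u \<bullet> x) - f x)"

text \<open>\<open>lambda_inf\<close> is an extended real: the infimum over the empty set is \<open>\<infinity>\<close>.\<close>

definition lambda_inf :: "real^'n^'m \<Rightarrow> real^'m \<Rightarrow> (real^'n \<Rightarrow> ereal) \<Rightarrow> ereal" where
  "lambda_inf A b p =
     (INF \<nu>\<in>{\<nu>::real. 0 \<le> \<nu> \<and> transpose A *v b \<in> (\<lambda>v. \<nu> *\<^sub>R v) ` subdifferential p 0}. ereal \<nu>)"

definition Omega :: "real^'n^'m \<Rightarrow> real^'m \<Rightarrow> (real^'n \<Rightarrow> ereal) \<Rightarrow> real \<Rightarrow> (real^'n) set" where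
  "Omega A b p l =
     {x. is_arg_min (\<lambda>x. ereal (1 / 2 * (norm (A *v x - b))\<^sup>2) + ereal l * p x) (\<lambda>_. True) x}"

text \<open>Meaningful only for \<open>l > 0\<close>; there the residual does not depend on the
  chosen minimizer, so the choice below is immaterial as soon as \<open>Omega A b p l \<noteq> {}\<close>.\<close>

definition phi :: "real^'n^'m \<Rightarrow> real^'m \<Rightarrow> (real^'n \<Rightarrow> ereal) \<Rightarrow> real \<Rightarrow> real" where
  "phi A b p l = norm (A *v (SOME x. x \<in> Omega A b p l) - b)"

definition clarke_jacobian :: "(real \<Rightarrow> real) \<Rightarrow> real \<Rightarrow> real set" where
  "clarke_jacobian f x =
     convex hull {d. \<exists>s g. s \<longlonglongrightarrow> x \<and> (\<forall>j::nat. (f has_real_derivative g j) (at (s j))) \<and> g \<longlonglongrightarrow> d}"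

text \<open>Indices are shifted by one: \<open>secant_seq f r l' l k\<close> is the iterate $\lambda_{k-1}$, with
  \<open>l'\<close> $= \lambda_{-1}$ and \<open>l\<close> $= \lambda_0$. A run that stops at an iterate with \<open>f\<close>-value \<open>r\<close> is
  continued as a constant sequence.\<close>

fun secant_seq :: "(real \<Rightarrow> real) \<Rightarrow> real \<Rightarrow> real \<Rightarrow> real \<Rightarrow> nat \<Rightarrow> real" where
  "secant_seq f r l' l 0 = l'"
| "secant_seq f r l' l (Suc 0) = l"
| "secant_seq f r l' l (Suc (Suc k)) =
     (let u = secant_seq f r l' l k; v = secant_seq f r l' l (Suc k)
      in if f v = r then v
         else v - inverse ((f v - f u) / (v - u)) * (f v - r))"

text \<open>No division by zero occurs before the method stops, and
  all iterates are positive, i.e. in the domain on which the method is applied to \<open>phi\<close>.\<close>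

definition secant_well_defined :: "(real \<Rightarrow> real) \<Rightarrow> real \<Rightarrow> (nat \<Rightarrow> real) \<Rightarrow> bool" where
  "secant_well_defined f r s \<longleftrightarrow>
     (\<forall>k. 0 < s k) \<and>
     (\<forall>k. f (s (Suc k)) \<noteq> r \<longrightarrow> s (Suc k) \<noteq> s k \<and> f (s (Suc k)) \<noteq> f (s k))"

definition Q_superlinear :: "(nat \<Rightarrow> real) \<Rightarrow> real \<Rightarrow> bool" where
  "Q_superlinear s L \<longleftrightarrow> (\<lambda>k. \<bar>s (Suc k) - L\<bar>) \<in> o(\<lambda>k. \<bar>s k - L\<bar>)"

text \<open>If \<open>s\<close> reaches \<open>L\<close> and stays there, the quotients are eventually \<open>0 / 0 = 0\<close>.\<close>

definition Q_order_at_least :: "real \<Rightarrow> (nat \<Rightarrow> real) \<Rightarrow> real \<Rightarrow> bool" where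
  "Q_order_at_least \<tau> s L \<longleftrightarrow>
     (\<forall>q\<in>{1..<\<tau>}. (\<lambda>k. \<bar>s (Suc k) - L\<bar> / \<bar>s k - L\<bar> powr q) \<longlonglongrightarrow> 0)"

end

theory Submission
  imports Defs
begin

text \<open>For \<open>\<lambda> > 0\<close> let \<open>y(\<lambda>) = b - A x(\<lambda>)\<close> be the residual, so that \<open>\<phi>(\<lambda>) = \<parallel>y(\<lambda>)\<parallel>\<close>, and let
  \<open>u(\<lambda>) = A\<^sup>T y(\<lambda>) / \<lambda>\<close> be the associated subgradient of \<open>p\<close> at \<open>x(\<lambda>)\<close>. The theorem holds because, near
  \<open>\<lambda>\<^sup>*\<close>, the function \<open>\<phi>\<close> is exactly of the form \<open>\<lambda> \<mapsto> sqrt (a + c \<lambda>\<^sup>2)\<close> with \<open>a \<ge> 0\<close> and \<open>c > 0\<close>.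

  The vector \<open>u(\<lambda>)\<close> exposes a face of the polyhedron \<open>epi p\<close>, and there are only finitely many faces.
  If two parameters \<open>\<lambda>, \<mu>\<close> expose the same face, then convex combinations of \<open>x(\<lambda>)\<close> and \<open>x(\<mu>)\<close>
  solve the problems in between (\<open>kkt_pair_segment\<close>), so \<open>y(\<nu>) = q + \<nu> \<beta>\<close> for \<open>\<nu>\<close> between them. Moreover
  \<open>u(\<lambda>) \<bullet> x(\<mu>) = u(\<mu>) \<bullet> x(\<mu>)\<close> and \<open>u(\<mu>) \<bullet> x(\<lambda>) = u(\<lambda>) \<bullet> x(\<lambda>)\<close> force \<open>q \<bullet> \<beta> = 0\<close>, whence
  \<open>\<phi>(\<nu>)\<^sup>2 = \<parallel>q\<parallel>\<^sup>2 + \<parallel>\<beta>\<parallel>\<^sup>2 \<nu>\<^sup>2\<close>; finiteness of \<open>\<lambda>\<^sub>\<infinity>\<close> and \<open>\<phi>(\<lambda>) < \<parallel>b\<parallel>\<close> exclude \<open>\<beta> = 0\<close>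
  (\<open>phi_sq_on_segment\<close>). Among parameters tending to \<open>\<lambda>\<^sup>*\<close> from one side, infinitely many expose the same
  face, so \<open>\<phi>\<^sup>2 = \<rho>\<^sup>2 + c (\<lambda>\<^sup>2 - (\<lambda>\<^sup>*)\<^sup>2)\<close> on each side of \<open>\<lambda>\<^sup>*\<close>, with a constant \<open>c\<close> that might depend on
  the side. Both one-sided derivatives \<open>c \<lambda>\<^sup>* / \<rho>\<close> belong to the Clarke Jacobian; as it is a singleton,
  the two constants agree (\<open>phi_local_form\<close>).

  For such a function the secant errors satisfy the exact recursion \<open>e\<^bsub>k+1\<^esub> = e\<^sub>k e\<^bsub>k-1\<^esub> K\<^sub>k\<close>, where \<open>K\<^sub>k\<close> is a
  continuous function of the two iterates whose value at \<open>(\<lambda>\<^sup>*, \<lambda>\<^sup>*)\<close> is \<open>a / (2 \<rho>\<^sup>2 \<lambda>\<^sup>*)\<close>. If \<open>a = 0\<close>, then \<open>\<phi>\<close> is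
  linear and \<open>K\<^sub>k = 0\<close>. Otherwise \<open>K\<^sub>k\<close> stays between two positive constants
  (\<open>secant_factor_bounds\<close>). The lower bound matters: an upper bound alone yields only the
  R-order. With it, \<open>ln \<bar>e\<^bsub>k+1\<^esub>\<bar> - \<tau> ln \<bar>e\<^sub>k\<bar>\<close> is bounded for the golden ratio \<open>\<tau>\<close>, and
  this is the claimed Q-order (\<open>Q_order_golden_ratio\<close>).\<close>

section \<open>Optimality pairs of the regularized problem\<close>

text \<open>Optimality system at the parameter \<open>l\<close>: \<open>u\<close> is a subgradient of the gauge \<open>p\<close> at \<open>x\<close>, and
  \<open>A\<^sup>T (b - A x) = l u\<close>. For a gauge, \<open>u \<in> \<partial>p(x)\<close> amounts to \<open>u \<in> \<partial>p(0)\<close> together with \<open>p x = u \<bullet> x\<close>.\<close>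
definition kkt_pair ::
  "real^'n^'m \<Rightarrow> real^'m \<Rightarrow> (real^'n \<Rightarrow> ereal) \<Rightarrow> real \<Rightarrow> real^'n \<Rightarrow> real^'n \<Rightarrow> bool" where
  "kkt_pair A b p l x u \<longleftrightarrow>
     u \<in> subdifferential p 0 \<and> p x = ereal (u \<bullet> x) \<and> transpose A *v (b - A *v x) = l *\<^sub>R u"

text \<open>The part of the epigraph on which \<open>(u, -1)\<close> vanishes. For \<open>u \<in> \<partial>p(0)\<close> this functional is nonpositive
  on the epigraph, so the set is a face; it is the graph of \<open>p\<close> over all points at which \<open>u\<close> is a subgradient.\<close>
definition exposed_face :: "('a::real_inner \<Rightarrow> ereal) \<Rightarrow> 'a \<Rightarrow> ('a \<times> real) set" where
  "exposed_face p u = epi p \<inter> {z. (u, -1) \<bullet> z = 0}"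

lemma inner_transpose_matrix:
  fixes A :: "real^'n^'m"
  shows "(transpose A *v y) \<bullet> x = y \<bullet> (A *v x)"
  by (simp add: dot_lmul_matrix)

lemma subdifferential_zero_iff:
  assumes "gauge_fun p"
  shows "v \<in> subdifferential p 0 \<longleftrightarrow> (\<forall>z. ereal (v \<bullet> z) \<le> p z)"
  using assms by (simp add: subdifferential_def gauge_fun_def zero_ereal_def[symmetric])

lemma subdifferential_zero_iff_epi:
  assumes g: "gauge_fun p"
  shows "v \<in> subdifferential p 0 \<longleftrightarrow> (\<forall>(z, t)\<in>epi p. v \<bullet> z \<le> t)"
proof -
  have "ereal (v \<bullet> z) \<le> p z" if H: "\<forall>(z, t)\<in>epi p. v \<bullet> z \<le> t" for z
  proof (cases "p z")
    case (real r)
    then have "(z, r) \<in> epi p" by (simp add: epi_def)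
    with H real show ?thesis by auto
  next
    case MInf
    with g show ?thesis unfolding gauge_fun_def by (metis ereal_infty_less_eq(2) MInfty_neq_ereal(1) zero_ereal_def)
  qed auto
  then show ?thesis
    unfolding subdifferential_zero_iff[OF g] epi_def using order_trans by fastforce
qed

text \<open>A closed gauge is the support function of its subdifferential at the origin. This is where
  closedness enters, through the separation of a point from the epigraph.\<close>
lemma gauge_less_support:
  fixes p :: "'a::euclidean_space \<Rightarrow> ereal"
  assumes g: "gauge_fun p" and c: "closed_fun p" and lt: "ereal t < p x"
  shows "\<exists>z\<in>subdifferential p 0. t < z \<bullet> x"
proof -
  have "convex (epi p)" "closed (epi p)" "(x, t) \<notin> epi p"
    using g c lt by (auto simp: gauge_fun_def convex_fun_def closed_fun_def epi_def)
  then obtain w \<beta> where w: "w \<bullet> (x, t) < \<beta>" "\<And>z. z \<in> epi p \<Longrightarrow> \<beta> < w \<bullet> z"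
    using separating_hyperplane_closed_point[of "epi p" "(x, t)"] by blast
  obtain v s where vs: "w = (v, s)" by (cases w)
  \<comment> \<open>The epigraph is a cone, so the functional \<open>w\<close> is nonnegative on it.\<close>
  have scale: "(r *\<^sub>R a, r * k) \<in> epi p" if "(a, k) \<in> epi p" "r > 0" for a k r
  proof -
    have "p (r *\<^sub>R a) = ereal r * p a" using g that by (simp add: gauge_fun_def)
    also have "\<dots> \<le> ereal r * ereal k"
      using that by (intro ereal_mult_left_mono) (auto simp: epi_def)
    finally show ?thesis by (simp add: epi_def)
  qed
  have "(0, 0) \<in> epi p" using g by (simp add: epi_def gauge_fun_def)
  from w(2)[OF this] have neg: "\<beta> < 0" by (simp add: vs inner_prod_def)
  have pos: "0 \<le> v \<bullet> a + s * k" if "(a, k) \<in> epi p" for a k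
  proof (rule ccontr)
    assume n: "\<not> ?thesis"
    define r where "r = \<beta> / (v \<bullet> a + s * k)"
    have "r > 0" using n neg by (simp add: r_def divide_neg_neg)
    from w(2)[OF scale[OF that this]] have "\<beta> < r * (v \<bullet> a + s * k)"
      by (simp add: vs inner_prod_def algebra_simps)
    with n show False by (simp add: r_def)
  qed
  have "(0, 1) \<in> epi p" using g by (simp add: epi_def gauge_fun_def)
  from pos[OF this] have s: "0 \<le> s" by simp
  have wx: "v \<bullet> x + s * t < 0" using w(1) neg by (simp add: vs inner_prod_def)
  show ?thesis
  proof (cases "s = 0")
    case False
    with s have s: "s > 0" by simp
    have "- (1 / s) *\<^sub>R v \<in> subdifferential p 0"
      unfolding subdifferential_zero_iff_epi[OF g]
    proof clarify
      fix a k assume "(a, k) \<in> epi p"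
      from pos[OF this] s show "(- (1 / s) *\<^sub>R v) \<bullet> a \<le> k" by (simp add: field_simps)
    qed
    moreover have "t < (- (1 / s) *\<^sub>R v) \<bullet> x" using wx s by (simp add: field_simps)
    ultimately show ?thesis by blast
  next
    case True
    \<comment> \<open>A vertical hyperplane: all multiples of \<open>- v\<close> by positive numbers lie in the subdifferential,
      and this multiple beats \<open>t\<close> at \<open>x\<close>.\<close>
    define n where "n = (\<bar>t\<bar> + 1) / \<bar>v \<bullet> x\<bar>"
    have vx: "v \<bullet> x < 0" using wx True by simp
    then have n: "n > 0" unfolding n_def by (intro divide_pos_pos) auto
    have "- n *\<^sub>R v \<in> subdifferential p 0"
      unfolding subdifferential_zero_iff_epi[OF g]
    proof clarify
      fix a k assume ak: "(a, k) \<in> epi p"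
      have "0 \<le> p a" "p a \<le> ereal k" using g ak by (auto simp: gauge_fun_def epi_def)
      then have "0 \<le> k" by (metis ereal_less_eq(5) order_trans)
      moreover have "0 \<le> v \<bullet> a" using pos[OF ak] True by simp
      ultimately show "(- n *\<^sub>R v) \<bullet> a \<le> k" using n by (smt (verit) inner_scaleR_left mult_nonneg_nonneg inner_minus_left scaleR_minus_left)
    qed
    moreover have "t < (- n *\<^sub>R v) \<bullet> x" using vx by (simp add: n_def)
    ultimately show ?thesis by blast
  qed
qed

lemma conjugate_gauge_eq_0:
  assumes g: "gauge_fun p" and z: "z \<in> subdifferential p 0"
  shows "conjugate p z = 0"
proof (rule antisym)
  show "conjugate p z \<le> 0"
    unfolding conjugate_def
  proof (rule SUP_least)
    fix x
    have "ereal (z \<bullet> x) \<le> p x" using z subdifferential_zero_iff[OF g] by blast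
    then show "ereal (z \<bullet> x) - p x \<le> 0" by (cases "p x") auto
  qed
  show "0 \<le> conjugate p z"
    unfolding conjugate_def using g by (intro SUP_upper2[of 0]) (auto simp: gauge_fun_def)
qed

text \<open>The conjugate of a gauge is the indicator function of its subdifferential at the origin, so that
  \<open>x \<in> \<partial>p\<^sup>*(u)\<close> says that \<open>u\<close> maximizes \<open>z \<mapsto> z \<bullet> x\<close> over that set.\<close>
lemma kkt_pair_of_conjugate:
  fixes A :: "real^'n^'m"
  assumes g: "gauge_fun p" and c: "closed_fun p"
    and x: "x \<in> subdifferential (conjugate p) u"
    and y: "y - b + A *v x = 0" "transpose A *v y - l *\<^sub>R u = 0"
  shows "kkt_pair A b p l x u"
proof -
  have x': "conjugate p u + ereal (x \<bullet> (z - u)) \<le> conjugate p z" for z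
    using x by (simp add: subdifferential_def)
  have C0: "0 \<in> subdifferential p 0"
    using g by (simp add: subdifferential_zero_iff) (simp add: gauge_fun_def zero_ereal_def[symmetric])
  have le: "conjugate p u \<le> ereal (x \<bullet> u)"
    using x'[of 0] conjugate_gauge_eq_0[OF g C0] by (cases "conjugate p u") auto
  have uC: "u \<in> subdifferential p 0"
    unfolding subdifferential_zero_iff[OF g]
  proof (rule allI, rule ccontr)
    fix z assume n: "\<not> ereal (u \<bullet> z) \<le> p z"
    have "0 \<le> p z" using g by (simp add: gauge_fun_def)
    with n obtain r where r: "p z = ereal r" "r < u \<bullet> z" by (cases "p z") auto
    \<comment> \<open>By homogeneity the conjugate at \<open>u\<close> exceeds any bound along the ray through \<open>z\<close>.\<close>
    define t where "t = (\<bar>x \<bullet> u\<bar> + 1) / (u \<bullet> z - r)"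
    have t: "t > 0" using r by (simp add: t_def)
    have "ereal (u \<bullet> (t *\<^sub>R z)) - p (t *\<^sub>R z) \<le> conjugate p u"
      unfolding conjugate_def by (rule SUP_upper) simp
    moreover have "p (t *\<^sub>R z) = ereal (t * r)" using g t r by (simp add: gauge_fun_def)
    ultimately have "ereal (t * (u \<bullet> z - r)) \<le> conjugate p u" by (simp add: algebra_simps)
    with le have "ereal (t * (u \<bullet> z - r)) \<le> ereal (x \<bullet> u)" by (rule order_trans[rotated])
    then have "t * (u \<bullet> z - r) \<le> x \<bullet> u" by simp
    moreover have "t * (u \<bullet> z - r) = \<bar>x \<bullet> u\<bar> + 1" using r by (simp add: t_def)
    ultimately show False by linarith
  qed
  have max: "z \<bullet> x \<le> u \<bullet> x" if "z \<in> subdifferential p 0" for z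
    using x'[of z] conjugate_gauge_eq_0[OF g uC] conjugate_gauge_eq_0[OF g that]
    by (simp add: inner_diff_right inner_commute)
  have "p x \<le> ereal (u \<bullet> x)"
    using gauge_less_support[OF g c, of "u \<bullet> x" x] max by (meson not_le)
  moreover have "ereal (u \<bullet> x) \<le> p x" using uC subdifferential_zero_iff[OF g] by blast
  moreover have "y = b - A *v x" using y(1) by (simp add: algebra_simps)
  ultimately show ?thesis using uC y(2) by (simp add: kkt_pair_def)
qed

text \<open>The objective grows at least like \<open>\<parallel>A (w - x)\<parallel>\<^sup>2 / 2\<close> away from \<open>x\<close>. Hence \<open>x\<close> is a minimizer, and every
  minimizer has the same residual.\<close>
lemma phi_eq_norm_residual:
  fixes A :: "real^'n^'m"
  assumes g: "gauge_fun p" and l: "l > 0" and k: "kkt_pair A b p l x u"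
  shows "phi A b p l = norm (b - A *v x)"
proof -
  let ?f = "\<lambda>x. ereal (1 / 2 * (norm (A *v x - b))\<^sup>2) + ereal l * p x"
  have u: "u \<in> subdifferential p 0" "p x = ereal (u \<bullet> x)" "transpose A *v (b - A *v x) = l *\<^sub>R u"
    using k by (auto simp: kkt_pair_def)
  have growth: "?f x + ereal (1 / 2 * (norm (A *v (w - x)))\<^sup>2) \<le> ?f w" for w
  proof -
    have "0 \<le> p w" "ereal (u \<bullet> w) \<le> p w"
      using g u(1) by (auto simp: gauge_fun_def subdifferential_zero_iff)
    moreover have "1 / 2 * (norm (A *v x - b))\<^sup>2 + l * (u \<bullet> x) + 1 / 2 * (norm (A *v (w - x)))\<^sup>2
        \<le> 1 / 2 * (norm (A *v w - b))\<^sup>2 + l * r" if "u \<bullet> w \<le> r" for r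
    proof -
      have "l * (u \<bullet> (w - x)) = (b - A *v x) \<bullet> (A *v (w - x))"
        using inner_transpose_matrix[of A "b - A *v x" "w - x"] u(3) by simp
      moreover have "A *v w - b = (A *v x - b) + A *v (w - x)"
        by (simp add: matrix_vector_mult_diff_distrib)
      then have "(norm (A *v w - b))\<^sup>2 = (norm (A *v x - b))\<^sup>2 + (norm (A *v (w - x)))\<^sup>2
          + 2 * ((A *v x - b) \<bullet> (A *v (w - x)))"
        by (simp only: power2_norm_eq_inner inner_add_left inner_add_right) (simp add: inner_commute)
      moreover have "(A *v x - b) \<bullet> (A *v (w - x)) = - ((b - A *v x) \<bullet> (A *v (w - x)))"
        by (metis inner_minus_left minus_diff_eq)
      moreover have "l * (u \<bullet> w) \<le> l * r" using l that by simp
      moreover have "l * (u \<bullet> (w - x)) = l * (u \<bullet> w) - l * (u \<bullet> x)"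
        by (simp add: inner_diff_right algebra_simps)
      ultimately show ?thesis by linarith
    qed
    ultimately show ?thesis using l u(2) by (cases "p w") auto
  qed
  have "?f x \<le> ?f w" for w
    using order_trans[OF _ growth[of w]] by (simp add: u(2))
  then have "x \<in> Omega A b p l" by (simp add: Omega_def is_arg_min_def not_less)
  then have w: "(SOME x. x \<in> Omega A b p l) \<in> Omega A b p l" (is "?w \<in> _") by (rule someI)
  then have "?f ?w \<le> ?f x" by (simp add: Omega_def is_arg_min_def not_less)
  with growth[of ?w] have "?f x + ereal (1 / 2 * (norm (A *v (?w - x)))\<^sup>2) \<le> ?f x"
    by (rule order_trans)
  then have "A *v (?w - x) = 0" by (simp add: u(2))
  then have "A *v ?w = A *v x" by (simp add: matrix_vector_mult_diff_distrib)
  then show ?thesis by (simp add: phi_def norm_minus_commute)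
qed

lemma kkt_pair_inner:
  fixes A :: "real^'n^'m"
  assumes "kkt_pair A b p l x u"
  shows "(b - A *v x) \<bullet> (A *v w) = l * (u \<bullet> w)"
  using assms inner_transpose_matrix[of A "b - A *v x" w] by (simp add: kkt_pair_def)

lemma kkt_pair_inner_le:
  fixes A :: "real^'n^'m"
  assumes g: "gauge_fun p" and k: "kkt_pair A b p l x u" and k': "kkt_pair A b p m x' u'"
  shows "u' \<bullet> x \<le> u \<bullet> x"
proof -
  have "ereal (u' \<bullet> x) \<le> p x" using k' subdifferential_zero_iff[OF g] unfolding kkt_pair_def by blast
  with k show ?thesis by (simp add: kkt_pair_def)
qed

section \<open>Dependence of the residual on the parameter\<close>

text \<open>Pairing the two residuals \<open>y, y'\<close> gives \<open>(l y' - m y) \<bullet> (y' - y) \<le> 0\<close>, a monotonicity property that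
  makes the residual locally Lipschitz in the parameter.\<close>
lemma kkt_pair_residual_growth:
  fixes A :: "real^'n^'m"
  assumes g: "gauge_fun p" and pos: "l > 0" "m > 0"
    and k: "kkt_pair A b p l x u" and k': "kkt_pair A b p m x' u'"
  shows "l * norm (A *v x - A *v x') \<le> \<bar>m - l\<bar> * norm (b - A *v x)"
proof -
  define y where "y = b - A *v x"
  define y' where "y' = b - A *v x'"
  have "u' \<bullet> x \<le> u \<bullet> x" "u \<bullet> x' \<le> u' \<bullet> x'"
    using kkt_pair_inner_le[OF g k k'] kkt_pair_inner_le[OF g k' k] by auto
  then have "l * (m * (u' \<bullet> x)) \<le> m * (l * (u \<bullet> x))" "m * (l * (u \<bullet> x')) \<le> l * (m * (u' \<bullet> x'))"
    using pos by auto
  then have "l * (y' \<bullet> (b - y)) \<le> m * (y \<bullet> (b - y))" "m * (y \<bullet> (b - y')) \<le> l * (y' \<bullet> (b - y'))"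
    using kkt_pair_inner[OF k] kkt_pair_inner[OF k'] by (simp_all add: y_def y'_def)
  then have "(l *\<^sub>R y' - m *\<^sub>R y) \<bullet> (y' - y) \<le> 0"
    by (simp add: algebra_simps inner_commute)
  moreover have "l *\<^sub>R y' - m *\<^sub>R y = l *\<^sub>R (y' - y) - (m - l) *\<^sub>R y" by (simp add: algebra_simps)
  ultimately have "l * (norm (y' - y))\<^sup>2 \<le> (m - l) * (y \<bullet> (y' - y))"
    by (simp add: inner_diff_left power2_norm_eq_inner)
  also have "\<dots> \<le> \<bar>m - l\<bar> * \<bar>y \<bullet> (y' - y)\<bar>" by (simp add: abs_mult[symmetric])
  also have "\<dots> \<le> \<bar>m - l\<bar> * (norm y * norm (y' - y))"
    by (intro mult_left_mono Cauchy_Schwarz_ineq2) auto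
  finally have "(l * norm (y' - y)) * norm (y' - y) \<le> (\<bar>m - l\<bar> * norm y) * norm (y' - y)"
    by (simp add: power2_eq_square mult.assoc)
  then have "l * norm (y' - y) \<le> \<bar>m - l\<bar> * norm y"
    by (cases "norm (y' - y) = 0") (auto dest: mult_right_le_imp_le)
  then show ?thesis by (simp add: y_def y'_def)
qed

text \<open>If \<open>u\<close> and \<open>u'\<close> are both subgradients at both points, then every point of the segment is optimal for
  the corresponding parameter. Its subgradient \<open>w\<close> is the convex combination of \<open>u\<close> and \<open>u'\<close> whose weights are the
  shares of \<open>l\<close> and \<open>m\<close> in the new parameter.\<close>
lemma kkt_pair_segment:
  fixes A :: "real^'n^'m"
  assumes g: "gauge_fun p" and pos: "l > 0" "m > 0"
    and k: "kkt_pair A b p l x u" and k': "kkt_pair A b p m x' u'"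
    and eq: "u' \<bullet> x = u \<bullet> x" "u \<bullet> x' = u' \<bullet> x'"
    and t: "0 \<le> t" "t \<le> 1"
  shows "\<exists>w. kkt_pair A b p ((1 - t) * l + t * m) ((1 - t) *\<^sub>R x + t *\<^sub>R x') w"
proof -
  define n where "n = (1 - t) * l + t * m"
  have n: "n > 0"
    unfolding n_def using t pos by (cases "t = 0") (auto intro: add_nonneg_pos)
  define w where "w = ((1 - t) * l / n) *\<^sub>R u + (t * m / n) *\<^sub>R u'"
  define z where "z = (1 - t) *\<^sub>R x + t *\<^sub>R x'"
  have sum1: "(1 - t) * l / n + t * m / n = 1" using n by (simp add: n_def add_divide_distrib[symmetric])
  have nn: "0 \<le> (1 - t) * l / n" "0 \<le> t * m / n" using n t pos by auto
  have wC: "w \<in> subdifferential p 0"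
    unfolding subdifferential_zero_iff_epi[OF g]
  proof clarify
    fix a k assume ak: "(a, k) \<in> epi p"
    then have "u \<bullet> a \<le> k" "u' \<bullet> a \<le> k"
      using k k' unfolding kkt_pair_def subdifferential_zero_iff_epi[OF g] by auto
    then have "w \<bullet> a \<le> ((1 - t) * l / n) * k + (t * m / n) * k"
      unfolding w_def inner_add_left inner_scaleR_left
      by (intro add_mono mult_left_mono nn)
    then show "w \<bullet> a \<le> k" by (simp only: distrib_right[symmetric] sum1 mult_1_left)
  qed
  have uz: "u \<bullet> z = (1 - t) * (u \<bullet> x) + t * (u' \<bullet> x')" "u' \<bullet> z = u \<bullet> z"
    by (simp_all add: z_def inner_add_right eq)
  have "w \<bullet> z = ((1 - t) * l / n + t * m / n) * (u \<bullet> z)"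
    unfolding w_def inner_add_left inner_scaleR_left uz(2) by (simp only: distrib_right)
  with sum1 have wz: "w \<bullet> z = u \<bullet> z" by simp
  have "convex (epi p)" using g by (simp add: gauge_fun_def convex_fun_def)
  moreover have "(x, u \<bullet> x) \<in> epi p" "(x', u' \<bullet> x') \<in> epi p"
    using k k' by (auto simp: kkt_pair_def epi_def)
  ultimately have "(1 - t) *\<^sub>R (x, u \<bullet> x) + t *\<^sub>R (x', u' \<bullet> x') \<in> epi p"
    using t by (intro convexD) auto
  then have "p z \<le> ereal (w \<bullet> z)" by (simp add: epi_def z_def[symmetric] wz uz)
  moreover have "ereal (w \<bullet> z) \<le> p z" using wC subdifferential_zero_iff[OF g] by blast
  moreover have "transpose A *v (b - A *v z) = n *\<^sub>R w"
  proof -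
    have "b - A *v z = (1 - t) *\<^sub>R (b - A *v x) + t *\<^sub>R (b - A *v x')"
      by (simp add: z_def matrix_vector_right_distrib matrix_vector_mult_scaleR algebra_simps)
    then have "transpose A *v (b - A *v z) = (1 - t) *\<^sub>R (l *\<^sub>R u) + t *\<^sub>R (m *\<^sub>R u')"
      using k k' by (simp only: kkt_pair_def matrix_vector_right_distrib matrix_vector_mult_scaleR)
    also have "\<dots> = n *\<^sub>R w" using n by (simp add: w_def scaleR_add_right)
    finally show ?thesis .
  qed
  ultimately show ?thesis
    using wC by (auto simp: kkt_pair_def n_def[symmetric] z_def[symmetric] intro!: exI[of _ w])
qed

lemma exposed_face_finite:
  fixes p :: "'a::euclidean_space \<Rightarrow> ereal"
  assumes g: "gauge_fun p" and ph: "polyhedral_fun p"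
  shows "finite (exposed_face p ` subdifferential p 0)"
proof (rule finite_subset)
  show "exposed_face p ` subdifferential p 0 \<subseteq> {F. F face_of epi p}"
  proof clarify
    fix u assume "u \<in> subdifferential p 0"
    then show "exposed_face p u face_of epi p"
      using g unfolding exposed_face_def subdifferential_zero_iff_epi[OF g]
      by (intro face_of_Int_supporting_hyperplane_le)
        (auto simp: gauge_fun_def convex_fun_def inner_prod_def)
  qed
  show "finite {F. F face_of epi p}"
    using ph by (simp add: polyhedral_fun_def finite_polyhedron_faces)
qed

text \<open>The graph point over \<open>x'\<close> lies on the common face, so \<open>u\<close> is a subgradient at \<open>x'\<close> as well.\<close>
lemma exposed_face_eqD:
  assumes k: "kkt_pair A b p l x u" and k': "kkt_pair A b p m x' u'"
    and eq: "exposed_face p u = exposed_face p u'"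
  shows "u \<bullet> x' = u' \<bullet> x'"
proof -
  have "(x', u' \<bullet> x') \<in> exposed_face p u'"
    using k' by (simp add: exposed_face_def epi_def kkt_pair_def inner_prod_def)
  with eq have "(x', u' \<bullet> x') \<in> exposed_face p u" by simp
  then show ?thesis by (simp add: exposed_face_def inner_prod_def)
qed

text \<open>Finiteness of \<open>lambda_inf\<close> enters only through the existence of some admissible \<open>\<nu>\<close>.\<close>
lemma lambda_inf_finiteD:
  assumes "lambda_inf A b p < \<infinity>"
  shows "\<exists>\<nu>\<ge>0. \<exists>v\<in>subdifferential p 0. transpose A *v b = \<nu> *\<^sub>R v"
proof -
  let ?N = "{\<nu>::real. 0 \<le> \<nu> \<and> transpose A *v b \<in> (\<lambda>v. \<nu> *\<^sub>R v) ` subdifferential p 0}"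
  have "?N \<noteq> {}"
  proof
    assume "?N = {}"
    then have "lambda_inf A b p = \<infinity>" unfolding lambda_inf_def by (simp only: image_empty Inf_empty top_ereal_def)
    with assms show False by simp
  qed
  then show ?thesis by blast
qed

text \<open>Equal residuals at two different parameters force \<open>(b - A x) \<bullet> A x = 0\<close> and hence \<open>u \<bullet> x = 0\<close>. As \<open>A\<^sup>T b\<close> is a
  nonnegative multiple of some \<open>v \<in> \<partial>p(0)\<close>, also \<open>b \<bullet> A x \<le> 0\<close>, which leaves only \<open>A x = 0\<close>.\<close>
lemma kkt_pair_residual_neq:
  fixes A :: "real^'n^'m"
  assumes g: "gauge_fun p" and lm: "l \<noteq> m" and pos: "l > 0" "m > 0"
    and k: "kkt_pair A b p l x u" and k': "kkt_pair A b p m x' u'"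
    and v: "\<nu> \<ge> 0" "v \<in> subdifferential p 0" "transpose A *v b = \<nu> *\<^sub>R v"
    and nz: "A *v x \<noteq> 0"
  shows "A *v x \<noteq> A *v x'"
proof
  assume eq: "A *v x = A *v x'"
  define s where "s = (b - A *v x) \<bullet> (A *v x)"
  have s: "s = l * (u \<bullet> x)" "s = m * (u' \<bullet> x)" "s = l * (u \<bullet> x')" "s = m * (u' \<bullet> x')"
    using kkt_pair_inner[OF k, of x] kkt_pair_inner[OF k', of x]
      kkt_pair_inner[OF k, of x'] kkt_pair_inner[OF k', of x'] eq
    unfolding s_def by metis+
  have "u' \<bullet> x \<le> u \<bullet> x" "u \<bullet> x' \<le> u' \<bullet> x'"
    using kkt_pair_inner_le[OF g k k'] kkt_pair_inner_le[OF g k' k] by auto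
  then have "l * (m * (u' \<bullet> x)) \<le> m * (l * (u \<bullet> x))" "m * (l * (u \<bullet> x')) \<le> l * (m * (u' \<bullet> x'))"
    using pos by auto
  then have "l * s \<le> m * s" "m * s \<le> l * s" using s by metis+
  then have "l * s = m * s" by (rule antisym)
  with lm have s0: "s = 0" by simp
  with s(1) pos have ux: "u \<bullet> x = 0" by simp
  have "ereal (v \<bullet> x) \<le> p x" using v(2) subdifferential_zero_iff[OF g] by blast
  with k ux have "v \<bullet> x \<le> 0" by (simp add: kkt_pair_def)
  then have "b \<bullet> (A *v x) \<le> 0"
    using inner_transpose_matrix[of A b x] v(1,3) by (simp del: transpose_matrix_vector) (metis mult_nonneg_nonpos)
  moreover have "b \<bullet> (A *v x) = s + (A *v x) \<bullet> (A *v x)"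
    by (simp add: s_def inner_diff_left)
  ultimately show False using s0 nz by (smt (verit) inner_gt_zero_iff)
qed

text \<open>Between two parameters that expose the same face the residual is \<open>q + z \<beta>\<close>. The monotonicity
  inequality of \<open>kkt_pair_residual_growth\<close> becomes an equality here, and this gives \<open>q \<bullet> \<beta> = 0\<close>.\<close>
lemma phi_sq_on_segment:
  fixes A :: "real^'n^'m"
  assumes g: "gauge_fun p" and lm: "l \<noteq> m" and pos: "l > 0" "m > 0"
    and k: "kkt_pair A b p l x u" and k': "kkt_pair A b p m x' u'"
    and face: "exposed_face p u = exposed_face p u'"
    and v: "\<nu> \<ge> 0" "v \<in> subdifferential p 0" "transpose A *v b = \<nu> *\<^sub>R v"
    and lt: "phi A b p l < norm b"
  shows "\<exists>a c. 0 \<le> a \<and> 0 < c \<and> (\<forall>z\<in>closed_segment l m. (phi A b p z)\<^sup>2 = a + c * z\<^sup>2)"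
proof -
  define y where "y = b - A *v x"
  define y' where "y' = b - A *v x'"
  define \<beta> where "\<beta> = (1 / (m - l)) *\<^sub>R (y' - y)"
  define q where "q = y - l *\<^sub>R \<beta>"
  have eq: "u \<bullet> x' = u' \<bullet> x'" "u' \<bullet> x = u \<bullet> x"
    using exposed_face_eqD[OF k k' face] exposed_face_eqD[OF k' k face[symmetric]] by auto
  have "A *v x \<noteq> 0" using phi_eq_norm_residual[OF g pos(1) k] lt by auto
  from kkt_pair_residual_neq[OF g lm pos k k' v this] have "\<beta> \<noteq> 0"
    using lm by (simp add: \<beta>_def y_def y'_def)
  have y': "y' - y = (m - l) *\<^sub>R \<beta>" using lm by (simp add: \<beta>_def)
  then have y'q: "y' = q + m *\<^sub>R \<beta>" and yq: "y = q + l *\<^sub>R \<beta>"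
    by (simp_all add: q_def algebra_simps)
  have "l * (m * (u' \<bullet> x)) = m * (l * (u \<bullet> x))" "m * (l * (u \<bullet> x')) = l * (m * (u' \<bullet> x'))"
    using eq by auto
  then have "l * (y' \<bullet> (b - y)) = m * (y \<bullet> (b - y))" "m * (y \<bullet> (b - y')) = l * (y' \<bullet> (b - y'))"
    using kkt_pair_inner[OF k] kkt_pair_inner[OF k'] by (simp_all add: y_def y'_def)
  then have "(l *\<^sub>R y' - m *\<^sub>R y) \<bullet> (y' - y) = 0"
    by (simp add: algebra_simps inner_commute)
  moreover have "l *\<^sub>R y' - m *\<^sub>R y = (l - m) *\<^sub>R q" unfolding y'q yq by (simp add: algebra_simps)
  ultimately have orth: "q \<bullet> \<beta> = 0" using lm by (simp add: y')
  have "(phi A b p z)\<^sup>2 = (norm q)\<^sup>2 + (norm \<beta>)\<^sup>2 * z\<^sup>2" if z: "z \<in> closed_segment l m" for z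
  proof -
    from z obtain t where t: "0 \<le> t" "t \<le> 1" "z = (1 - t) * l + t * m" by (auto simp: in_segment)
    obtain w where w: "kkt_pair A b p z ((1 - t) *\<^sub>R x + t *\<^sub>R x') w"
      using kkt_pair_segment[OF g pos k k' eq(2,1) t(1,2)] t(3) by auto
    have "z > 0" unfolding t(3) using t pos by (cases "t = 0") (auto intro: add_nonneg_pos)
    from phi_eq_norm_residual[OF g this w]
    have "phi A b p z = norm ((1 - t) *\<^sub>R y + t *\<^sub>R y')"
      by (simp add: y_def y'_def matrix_vector_right_distrib matrix_vector_mult_scaleR algebra_simps)
    also have "(1 - t) *\<^sub>R y + t *\<^sub>R y' = q + z *\<^sub>R \<beta>"
      unfolding y'q yq t(3) by (simp add: algebra_simps)
    finally show ?thesis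
      using orth norm_add_Pythagorean[of q "z *\<^sub>R \<beta>"]
      by (simp add: orthogonal_def power_mult_distrib mult.commute)
  qed
  moreover have "0 < (norm \<beta>)\<^sup>2" using \<open>\<beta> \<noteq> 0\<close> by simp
  ultimately show ?thesis by (intro exI[of _ "(norm q)\<^sup>2"] exI[of _ "(norm \<beta>)\<^sup>2"]) auto
qed

lemma isCont_phi:
  fixes A :: "real^'n^'m"
  assumes g: "gauge_fun p" and K: "\<And>l. l > 0 \<Longrightarrow> \<exists>x u. kkt_pair A b p l x u" and L: "L > 0"
  shows "isCont (phi A b p) L"
proof -
  have "dist (phi A b p m) (phi A b p L) \<le> \<bar>m - L\<bar> * (phi A b p L / L)" if m: "m > 0" for m
  proof -
    from K[OF L] K[OF m] obtain x u x' u'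
      where k: "kkt_pair A b p L x u" and k': "kkt_pair A b p m x' u'" by blast
    have "\<bar>phi A b p m - phi A b p L\<bar> \<le> norm (A *v x - A *v x')"
      unfolding phi_eq_norm_residual[OF g L k] phi_eq_norm_residual[OF g m k']
      using norm_triangle_ineq3[of "b - A *v x'" "b - A *v x"] by (simp add: algebra_simps)
    also have "\<dots> \<le> \<bar>m - L\<bar> * (norm (b - A *v x) / L)"
      using kkt_pair_residual_growth[OF g L m k k'] L by (simp add: field_simps)
    finally show ?thesis by (simp add: dist_real_def phi_eq_norm_residual[OF g L k])
  qed
  then have ev: "\<forall>\<^sub>F m in at L. dist (phi A b p m) (phi A b p L) \<le> \<bar>m - L\<bar> * (phi A b p L / L)"
    using eventually_at_in_open'[of "{0<..}" L] L by (auto elim: eventually_mono)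
  have "((\<lambda>m. \<bar>m - L\<bar> * (phi A b p L / L)) \<longlongrightarrow> \<bar>L - L\<bar> * (phi A b p L / L)) (at L)"
    by (intro tendsto_intros)
  then have "((\<lambda>m. dist (phi A b p m) (phi A b p L)) \<longlongrightarrow> 0) (at L)"
    by (intro tendsto_sandwich[OF _ ev tendsto_const]) auto
  then show ?thesis unfolding isCont_def by (rule iffD2[OF tendsto_dist_iff])
qed

section \<open>The value function near the solution\<close>

lemma shrinking_tendsto_0: "(\<lambda>n. d / (real n + 2)) \<longlonglongrightarrow> (0::real)"
  using LIMSEQ_ignore_initial_segment[OF lim_const_over_n[of d], of 2] by (simp add: add.commute)

text \<open>The sign \<open>\<sigma>\<close> selects the side of \<open>L\<close>. The points \<open>t n\<close> tend to \<open>L\<close> from that side, and by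
  the pigeonhole principle infinitely many of them expose the same face.\<close>
lemma phi_sq_one_sided:
  fixes A :: "real^'n^'m"
  assumes g: "gauge_fun p" and ph: "polyhedral_fun p"
    and K: "\<And>l. l > 0 \<Longrightarrow> \<exists>x u. kkt_pair A b p l x u" and L: "L > 0"
    and fin: "lambda_inf A b p < \<infinity>"
    and rho: "0 < phi A b p L" "phi A b p L < norm b"
    and \<sigma>: "\<sigma> = 1 \<or> \<sigma> = -1"
  shows "\<exists>\<epsilon>>0. \<exists>c>0. c * L\<^sup>2 \<le> (phi A b p L)\<^sup>2 \<and>
    (\<forall>z. 0 < \<sigma> * (z - L) \<and> \<sigma> * (z - L) < \<epsilon> \<longrightarrow>
      0 < phi A b p z \<and> (phi A b p z)\<^sup>2 = (phi A b p L)\<^sup>2 + c * (z\<^sup>2 - L\<^sup>2))"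
proof -
  let ?f = "phi A b p"
  obtain \<nu> v where v: "\<nu> \<ge> 0" "v \<in> subdifferential p 0" "transpose A *v b = \<nu> *\<^sub>R v"
    using lambda_inf_finiteD[OF fin] by blast
  note cont = isCont_phi[OF g K L, unfolded isCont_def]
  have "\<forall>\<^sub>F z in at L. 0 < ?f z \<and> ?f z < norm b \<and> 0 < z"
    using order_tendstoD[OF cont] rho eventually_at_in_open'[of "{0<..}" L] L
    by (auto intro!: eventually_conj)
  then obtain d where d: "d > 0"
    "\<And>z. z \<noteq> L \<Longrightarrow> dist z L < d \<Longrightarrow> 0 < ?f z \<and> ?f z < norm b \<and> 0 < z"
    unfolding eventually_at by blast
  define h where "h n = d / (real n + 2)" for n
  define t where "t n = L + \<sigma> * h n" for n
  have h: "0 < h n" "h n < d" for n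
    using d by (auto simp: h_def field_simps intro: add_pos_nonneg)
  have t: "0 < ?f (t n)" "?f (t n) < norm b" "0 < t n" for n
    using d(2)[of "t n"] h[of n] \<sigma> by (auto simp: t_def dist_real_def)
  have "\<exists>x u. kkt_pair A b p (t n) x u" for n using K t(3) by blast
  then obtain X U where XU: "\<And>n. kkt_pair A b p (t n) (X n) (U n)" by metis
  have "(\<lambda>n. exposed_face p (U n)) ` UNIV \<subseteq> exposed_face p ` subdifferential p 0"
    using XU by (auto simp: kkt_pair_def)
  from finite_subset[OF this exposed_face_finite[OF g ph]]
  have "finite ((\<lambda>n. exposed_face p (U n)) ` UNIV)" .
  from pigeonhole_infinite[OF infinite_UNIV_nat this] obtain j
    where inf: "infinite {n. exposed_face p (U n) = exposed_face p (U j)}" by auto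
  define S where "S = {n. exposed_face p (U n) = exposed_face p (U j)}"
  have S: "\<exists>n\<in>S. n > N" for N
    using inf unfolding S_def[symmetric] by (meson infinite_nat_iff_unbounded)
  obtain n0 where n0: "n0 \<in> S" using S by blast
  obtain n1 where n1: "n1 \<in> S" "n1 > n0" using S by blast
  have hmono: "h n < h m" if "m < n" for m n
    using that d(1) by (auto simp: h_def intro!: divide_strict_left_mono)
  have quad: "\<exists>a c. 0 \<le> a \<and> 0 < c \<and> (\<forall>z\<in>closed_segment (t n0) (t n). (?f z)\<^sup>2 = a + c * z\<^sup>2)"
    if n: "n \<in> S" "n > n0" for n
  proof (rule phi_sq_on_segment[OF g _ t(3) t(3) XU XU _ v t(2)])
    show "t n0 \<noteq> t n" using hmono[OF n(2)] \<sigma> by (auto simp: t_def)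
    show "exposed_face p (U n0) = exposed_face p (U n)" using n n0 by (simp add: S_def)
  qed
  obtain a c where ac: "0 \<le> a" "0 < c" "\<And>z. z \<in> closed_segment (t n0) (t n1) \<Longrightarrow> (?f z)\<^sup>2 = a + c * z\<^sup>2"
    using quad[OF n1] by blast
  have seg: "z \<in> closed_segment (t n0) (t n)" if "h n \<le> \<sigma> * (z - L)" "\<sigma> * (z - L) \<le> h n0" for z n
    using that \<sigma> by (auto simp: t_def closed_segment_eq_real_ivl)
  have ext: "(?f z)\<^sup>2 = a + c * z\<^sup>2" if z: "0 < \<sigma> * (z - L)" "\<sigma> * (z - L) < h n0" for z
  proof -
    have "(\<lambda>n. h n) \<longlonglongrightarrow> 0" unfolding h_def by (rule shrinking_tendsto_0)
    from order_tendstoD(2)[OF this z(1)] obtain N where N: "\<And>n. n \<ge> N \<Longrightarrow> h n < \<sigma> * (z - L)"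
      by (auto simp: eventually_sequentially)
    obtain k where k: "k \<in> S" "k > max N n1" using S by blast
    then have "k > n0" using n1 by simp
    \<comment> \<open>The quadratics belonging to the segments up to \<open>t n1\<close> and up to \<open>t k\<close> agree at \<open>t n0\<close> and \<open>t n1\<close>,
      hence are the same.\<close>
    from quad[OF k(1) this] obtain a' c'
      where ac': "\<And>z. z \<in> closed_segment (t n0) (t k) \<Longrightarrow> (?f z)\<^sup>2 = a' + c' * z\<^sup>2" by blast
    have "\<sigma> * (t n - L) = h n" for n using \<sigma> by (auto simp: t_def)
    then have "t n1 \<in> closed_segment (t n0) (t k)"
      using hmono[of n1 k] hmono[of n0 n1] n1 k by (intro seg) auto
    then have e: "a + c * (t n0)\<^sup>2 = a' + c' * (t n0)\<^sup>2" "a + c * (t n1)\<^sup>2 = a' + c' * (t n1)\<^sup>2"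
      using ac(3)[of "t n0"] ac(3)[of "t n1"] ac'[of "t n0"] ac'[of "t n1"] by auto
    have "t n0 \<noteq> t n1" using hmono[OF n1(2)] \<sigma> by (auto simp: t_def)
    then have ne: "(t n0)\<^sup>2 - (t n1)\<^sup>2 \<noteq> 0" using t(3)[of n0] t(3)[of n1] by (simp add: power2_eq_iff)
    have "(c - c') * ((t n0)\<^sup>2 - (t n1)\<^sup>2) = 0" using e by (simp add: algebra_simps)
    with ne have "c' = c" by simp
    with e have "a' = a" by simp
    moreover have "z \<in> closed_segment (t n0) (t k)"
      using N[of k] k z by (intro seg) auto
    ultimately show ?thesis using ac' \<open>c' = c\<close> by simp
  qed
  have "a + c * L\<^sup>2 = (?f L)\<^sup>2"
  proof (rule tendsto_unique)
    have "(\<lambda>n. t n) \<longlonglongrightarrow> L"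
      using tendsto_add[OF tendsto_const[of L] tendsto_mult[OF tendsto_const[of \<sigma>] shrinking_tendsto_0[of d]]]
      by (simp add: t_def[abs_def] h_def)
    then show "(\<lambda>n. a + c * (t n)\<^sup>2) \<longlonglongrightarrow> a + c * L\<^sup>2" by (intro tendsto_intros)
    have "(\<lambda>n. (?f (t n))\<^sup>2) \<longlonglongrightarrow> (?f L)\<^sup>2"
      using isCont_tendsto_compose[OF isCont_phi[OF g K L] \<open>t \<longlonglongrightarrow> L\<close>] by (intro tendsto_intros)
    moreover have "(?f (t n))\<^sup>2 = a + c * (t n)\<^sup>2" if "n > n0" for n
      using hmono[OF that] h[of n] \<sigma> by (intro ext) (auto simp: t_def)
    then have "\<forall>\<^sub>F n in sequentially. (?f (t n))\<^sup>2 = a + c * (t n)\<^sup>2"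
      using eventually_gt_at_top[of n0] by (rule eventually_mono[rotated])
    ultimately show "(\<lambda>n. a + c * (t n)\<^sup>2) \<longlonglongrightarrow> (?f L)\<^sup>2"
      by (rule Lim_transform_eventually)
  qed simp
  then have a: "a = (?f L)\<^sup>2 - c * L\<^sup>2" by simp
  have "0 < ?f z" if "0 < \<sigma> * (z - L)" "\<sigma> * (z - L) < h n0" for z
    using that h[of n0] \<sigma> d(2)[of z] by (auto simp: dist_real_def)
  with ext h(1)[of n0] ac(1,2) show ?thesis unfolding a
    by (intro exI[of _ "h n0"] conjI exI[of _ c]) (auto simp: algebra_simps)
qed

text \<open>The number \<open>c * L / r\<close> is the limit of the derivatives along a sequence on the side \<open>\<sigma>\<close>.\<close>
lemma clarke_jacobian_one_sided:
  assumes \<epsilon>: "0 < \<epsilon>" and \<sigma>: "\<sigma> = 1 \<or> \<sigma> = -1" and r: "0 < r"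
    and f: "\<And>z. 0 < \<sigma> * (z - L) \<Longrightarrow> \<sigma> * (z - L) < \<epsilon> \<Longrightarrow> 0 < f z \<and> (f z)\<^sup>2 = r\<^sup>2 + c * (z\<^sup>2 - L\<^sup>2)"
  shows "c * L / r \<in> clarke_jacobian f L"
proof -
  define s where "s j = L + \<sigma> * (\<epsilon> / (real j + 2))" for j :: nat
  let ?F = "\<lambda>z. sqrt (r\<^sup>2 + c * (z\<^sup>2 - L\<^sup>2))"
  define S where "S = {z. 0 < \<sigma> * (z - L) \<and> \<sigma> * (z - L) < \<epsilon>}"
  have S: "open S"
    unfolding S_def by (intro open_Collect_conj open_Collect_less continuous_intros)
  have sS: "s j \<in> S" for j
    using \<epsilon> \<sigma> by (auto simp: S_def s_def field_simps intro!: add_pos_nonneg mult_nonneg_nonneg)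
  have fS: "?F z = f z" "0 < r\<^sup>2 + c * (z\<^sup>2 - L\<^sup>2)" if "z \<in> S" for z
  proof -
    have z: "0 < f z" "(f z)\<^sup>2 = r\<^sup>2 + c * (z\<^sup>2 - L\<^sup>2)" using f[of z] that by (auto simp: S_def)
    then show "?F z = f z" by (intro real_sqrt_unique) auto
    show "0 < r\<^sup>2 + c * (z\<^sup>2 - L\<^sup>2)" using z by (metis zero_less_power)
  qed
  have lim: "s \<longlonglongrightarrow> L"
    using tendsto_add[OF tendsto_const[of L] tendsto_mult[OF tendsto_const[of \<sigma>] shrinking_tendsto_0[of \<epsilon>]]]
    by (simp add: s_def[abs_def])
  have "(f has_real_derivative c * s j / ?F (s j)) (at (s j))" for j
  proof (rule has_field_derivative_transform_within_open[OF _ S sS])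
    show "(?F has_real_derivative c * s j / ?F (s j)) (at (s j))"
      using fS(2)[OF sS[of j]] by (auto intro!: derivative_eq_intros simp: divide_simps)
  qed (rule fS)
  moreover have "(\<lambda>j. c * s j / ?F (s j)) \<longlonglongrightarrow> c * L / r"
  proof -
    have "(\<lambda>j. c * s j / ?F (s j)) \<longlonglongrightarrow> c * L / sqrt (r\<^sup>2 + c * (L\<^sup>2 - L\<^sup>2))"
      using r by (intro tendsto_intros lim) simp
    then show ?thesis using r by simp
  qed
  ultimately have "c * L / r \<in> {d. \<exists>s g. s \<longlonglongrightarrow> L \<and>
      (\<forall>j::nat. (f has_real_derivative g j) (at (s j))) \<and> g \<longlonglongrightarrow> d}"
    using lim by (intro CollectI exI[of _ s] exI[of _ "\<lambda>j. c * s j / ?F (s j)"]) simp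
  then show ?thesis unfolding clarke_jacobian_def by (rule hull_inc)
qed

lemma phi_local_form:
  fixes A :: "real^'n^'m"
  assumes g: "gauge_fun p" and ph: "polyhedral_fun p"
    and K: "\<And>l. l > 0 \<Longrightarrow> \<exists>x u. kkt_pair A b p l x u" and L: "L > 0"
    and fin: "lambda_inf A b p < \<infinity>"
    and rho: "0 < phi A b p L" "phi A b p L < norm b"
    and clarke: "is_singleton (clarke_jacobian (phi A b p) L)"
  shows "\<exists>\<epsilon>>0. \<exists>a\<ge>0. \<exists>c>0. \<forall>z. \<bar>z - L\<bar> < \<epsilon> \<longrightarrow> phi A b p z = sqrt (a + c * z\<^sup>2)"
proof -
  let ?f = "phi A b p"
  note one = phi_sq_one_sided[OF g ph K L fin rho]
  obtain \<epsilon>1 c where 1: "\<epsilon>1 > 0" "c > 0" "c * L\<^sup>2 \<le> (?f L)\<^sup>2"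
    "\<And>z. 0 < 1 * (z - L) \<Longrightarrow> 1 * (z - L) < \<epsilon>1 \<Longrightarrow> 0 < ?f z \<and> (?f z)\<^sup>2 = (?f L)\<^sup>2 + c * (z\<^sup>2 - L\<^sup>2)"
    using one[of 1] by blast
  obtain \<epsilon>2 c' where 2: "\<epsilon>2 > 0" "c' > 0"
    "\<And>z. 0 < -1 * (z - L) \<Longrightarrow> -1 * (z - L) < \<epsilon>2 \<Longrightarrow> 0 < ?f z \<and> (?f z)\<^sup>2 = (?f L)\<^sup>2 + c' * (z\<^sup>2 - L\<^sup>2)"
    using one[of "-1"] by blast
  have "c * L / ?f L \<in> clarke_jacobian ?f L" "c' * L / ?f L \<in> clarke_jacobian ?f L"
    using clarke_jacobian_one_sided[OF 1(1) _ rho(1) 1(4)]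
      clarke_jacobian_one_sided[OF 2(1) _ rho(1) 2(3)] by blast+
  with clarke have "c * L / ?f L = c' * L / ?f L" by (metis is_singleton_def singletonD)
  then have c': "c' = c" using L rho by simp
  define a where "a = (?f L)\<^sup>2 - c * L\<^sup>2"
  have "?f z = sqrt (a + c * z\<^sup>2)" if z: "\<bar>z - L\<bar> < min \<epsilon>1 \<epsilon>2" for z
  proof -
    consider "z = L" | "z > L" | "z < L" by linarith
    then have "0 < ?f z \<and> (?f z)\<^sup>2 = a + c * z\<^sup>2"
    proof cases
      case 1
      with rho show ?thesis by (simp add: a_def)
    next
      case 2
      with 1(4)[of z] z show ?thesis by (simp add: a_def algebra_simps)
    next
      case 3
      with 2(3)[of z] z c' show ?thesis by (simp add: a_def algebra_simps)
    qed
    then show ?thesis by (metis less_imp_le real_sqrt_unique)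
  qed
  moreover have "0 \<le> a" using 1(3) by (simp add: a_def)
  ultimately show ?thesis using 1(1,2) 2(1)
    by (intro exI[of _ "min \<epsilon>1 \<epsilon>2"] conjI exI[of _ a] exI[of _ c]) auto
qed

section \<open>The secant method for square roots of quadratics\<close>

text \<open>The factor \<open>K\<close> in the error recursion \<open>e\<^sub>w = e\<^sub>v e\<^sub>u K\<close> of one secant step from \<open>u\<close>, \<open>v\<close> to \<open>w\<close>, for
  \<open>f z = sqrt (a + c z\<^sup>2)\<close> and the target value \<open>f L\<close>. It is written without divided differences, so it is
  continuous where \<open>u = v\<close>.\<close>
definition secant_factor :: "(real \<Rightarrow> real) \<Rightarrow> real \<Rightarrow> real \<Rightarrow> real \<Rightarrow> real \<Rightarrow> real" where
  "secant_factor f c L u v =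
     ((f v + f L) * (f u + f L) - c * (v + L) * (u + L)) / ((f u + f L) * (f v + f L) * (u + v))"

lemma secant_step_sqrt_quadratic:
  fixes f :: "real \<Rightarrow> real"
  assumes f_def: "\<And>z. f z = sqrt (a + c * z\<^sup>2)" and a: "a \<ge> 0" and c: "c > 0" and pos: "u > 0" "v > 0" "L > 0" and uv: "u \<noteq> v"
  shows "v - inverse ((f v - f u) / (v - u)) * (f v - f L) - L = (v - L) * (u - L) * secant_factor f c L u v"
proof -
  have f: "f z > 0" "(f z)\<^sup>2 = a + c * z\<^sup>2" if "z > 0" for z
    using a c that by (auto simp: f_def intro: add_nonneg_pos)
  have diff: "(f x - f y) * (f x + f y) = c * (x - y) * (x + y)" if "x > 0" "y > 0" for x y
  proof -
    have "(f x - f y) * (f x + f y) = (f x)\<^sup>2 - (f y)\<^sup>2" by (simp add: power2_eq_square algebra_simps)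
    then show ?thesis using f(2) that by (simp add: power2_eq_square algebra_simps)
  qed
  have p: "f u + f v > 0" "f v + f L > 0" "f u + f L > 0" "u + v > 0"
    using f(1) pos by (auto intro: add_pos_pos)
  have "f v - f u \<noteq> 0"
    using diff[OF pos(2,1)] p(4) c uv by auto
  moreover have "(v - u) * (c * (u + v)) = (f u + f v) * (f v - f u)"
    using diff[OF pos(2,1)] by (simp add: mult.commute mult.left_commute add.commute)
  ultimately have slope: "inverse ((f v - f u) / (v - u)) = (f u + f v) / (c * (u + v))"
    using p(4) c by (simp add: frac_eq_eq)
  have fv: "f v - f L = c * (v - L) * (v + L) / (f v + f L)"
    using diff[OF pos(2,3)] p by (simp add: field_simps)
  have "v - inverse ((f v - f u) / (v - u)) * (f v - f L) - L =
      (v - L) * (((f v + f L) * (u + v) - (v + L) * (f u + f v)) / ((f v + f L) * (u + v)))"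
    unfolding slope fv using p c by (simp add: divide_simps) (simp add: algebra_simps)
  also have "(f v + f L) * (u + v) - (v + L) * (f u + f v) =
      (f v + f L) * (u - L) - (v + L) * (f u - f L)"
    by (simp add: algebra_simps)
  also have "\<dots> = (u - L) * ((f v + f L) * (f u + f L) - c * (v + L) * (u + L)) / (f u + f L)"
  proof -
    have "((f v + f L) * (u - L) - (v + L) * (f u - f L)) * (f u + f L) =
        (f v + f L) * (u - L) * (f u + f L) - (v + L) * ((f u - f L) * (f u + f L))"
      by (simp add: algebra_simps)
    also have "\<dots> = (u - L) * ((f v + f L) * (f u + f L) - c * (v + L) * (u + L))"
      unfolding diff[OF pos(1,3)] by (simp add: algebra_simps)
    finally show ?thesis using p(3) by (simp add: eq_divide_eq)
  qed
  finally show ?thesis using p by (simp add: divide_simps secant_factor_def)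
qed

text \<open>The limit \<open>\<kappa>\<close> vanishes only if \<open>a = 0\<close>, in which case \<open>f\<close> is linear on the positive half-line and the
  factor vanishes identically.\<close>
lemma secant_factor_bounds:
  fixes f :: "real \<Rightarrow> real"
  assumes f_def: "\<And>z. f z = sqrt (a + c * z\<^sup>2)" and a: "a \<ge> 0" and c: "c > 0" and L: "L > 0"
  shows "\<exists>\<kappa>\<ge>0. \<exists>\<delta>>0. \<forall>u v. \<bar>u - L\<bar> < \<delta> \<longrightarrow> \<bar>v - L\<bar> < \<delta> \<longrightarrow>
    secant_factor f c L u v \<in> {\<kappa> / 2..2 * \<kappa>}"
proof (cases "a = 0")
  case True
  then have "f z = sqrt c * z" if "z \<ge> 0" for z
    using that c by (simp add: f_def real_sqrt_mult)
  then have "secant_factor f c L u v = 0" if "\<bar>u - L\<bar> < L" "\<bar>v - L\<bar> < L" for u v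
    using that L c by (simp add: secant_factor_def algebra_simps)
  then show ?thesis using L by (intro exI[of _ 0] conjI exI[of _ L]) auto
next
  case False
  with a have a: "a > 0" by simp
  define \<kappa> where "\<kappa> = a / (2 * (f L)\<^sup>2 * L)"
  have f: "f L > 0" "(f L)\<^sup>2 = a + c * L\<^sup>2" using a c L by (auto simp: f_def intro: add_pos_nonneg)
  have \<kappa>: "\<kappa> > 0"
    unfolding \<kappa>_def by (intro divide_pos_pos mult_pos_pos zero_less_power f(1) a L) simp
  let ?K = "\<lambda>x. secant_factor f c L (fst x) (snd x)"
  have "isCont ?K (L, L)"
    using f(1) L unfolding secant_factor_def f_def by (intro continuous_intros) auto
  moreover have "?K (L, L) = \<kappa>"
  proof -
    have "(f L + f L) * (f L + f L) - c * (L + L) * (L + L) = 4 * a"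
      using f(2) by (simp add: power2_eq_square algebra_simps)
    then have "?K (L, L) = 4 * a / ((f L + f L) * (f L + f L) * (L + L))"
      by (simp add: secant_factor_def)
    also have "\<dots> = \<kappa>" by (simp add: \<kappa>_def power2_eq_square)
    finally show ?thesis .
  qed
  ultimately have "(?K \<longlongrightarrow> \<kappa>) (nhds (L, L))"
    by (metis (no_types, lifting) isCont_def tendsto_at_iff_tendsto_nhds)
  then have "\<forall>\<^sub>F x in nhds (L, L). \<kappa> / 2 < ?K x \<and> ?K x < 2 * \<kappa>"
    using \<kappa> by (intro eventually_conj order_tendstoD) auto
  then obtain d where d: "d > 0" "\<And>x. dist x (L, L) < d \<Longrightarrow> \<kappa> / 2 < ?K x \<and> ?K x < 2 * \<kappa>"
    unfolding eventually_nhds_metric by blast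
  have "dist (u, v) (L, L) < d" if "\<bar>u - L\<bar> < d / 2" "\<bar>v - L\<bar> < d / 2" for u v
    using that sqrt_sum_squares_le_sum_abs[of "u - L" "v - L"]
    by (simp add: dist_Pair_Pair dist_real_def)
  with d(2) have "?K (u, v) \<in> {\<kappa> / 2..2 * \<kappa>}" if "\<bar>u - L\<bar> < d / 2" "\<bar>v - L\<bar> < d / 2" for u v
    using that by (meson atLeastAtMost_iff less_imp_le)
  then have "secant_factor f c L u v \<in> {\<kappa> / 2..2 * \<kappa>}" if "\<bar>u - L\<bar> < d / 2" "\<bar>v - L\<bar> < d / 2" for u v
    using that by fastforce
  then show ?thesis using \<kappa> d(1) by (intro exI[of _ \<kappa>] conjI exI[of _ "d / 2"]) auto
qed

lemma Q_superlinear_of_product_recursion: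
  fixes s :: "nat \<Rightarrow> real"
  assumes lim: "s \<longlonglongrightarrow> L"
    and rec: "\<And>k. \<bar>s (k + 2) - L\<bar> \<le> M * \<bar>s k - L\<bar> * \<bar>s (k + 1) - L\<bar>"
  shows "Q_superlinear s L"
  unfolding Q_superlinear_def
proof (rule landau_o.smallI)
  fix c :: real assume c: "c > 0"
  have "(\<lambda>k. M * \<bar>s k - L\<bar>) \<longlonglongrightarrow> M * \<bar>L - L\<bar>" by (intro tendsto_intros lim)
  then have "(\<lambda>k. M * \<bar>s k - L\<bar>) \<longlonglongrightarrow> 0" by simp
  from order_tendstoD(2)[OF this c] obtain N where N: "\<And>k. k \<ge> N \<Longrightarrow> M * \<bar>s k - L\<bar> < c"
    by (auto simp: eventually_sequentially)
  have "\<bar>s (Suc k) - L\<bar> \<le> c * \<bar>s k - L\<bar>" if "k \<ge> Suc N" for k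
  proof -
    define j where "j = k - 1"
    have j: "k = Suc j" "j \<ge> N" using that by (auto simp: j_def)
    have "\<bar>s (Suc k) - L\<bar> \<le> M * \<bar>s j - L\<bar> * \<bar>s k - L\<bar>" using rec[of j] j(1) by simp
    also have "\<dots> \<le> c * \<bar>s k - L\<bar>" using N[OF j(2)] by (intro mult_right_mono) auto
    finally show ?thesis .
  qed
  then show "\<forall>\<^sub>F k in sequentially. norm \<bar>s (Suc k) - L\<bar> \<le> c * norm \<bar>s k - L\<bar>"
    by (auto simp: eventually_sequentially)
qed

text \<open>For \<open>\<kappa> > 0\<close> the recursion reads \<open>x\<^bsub>k+2\<^esub> = x\<^bsub>k+1\<^esub> + x\<^sub>k + O(1)\<close> in terms of \<open>x\<^sub>k = ln \<bar>s k - L\<bar>\<close>. Since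
  \<open>\<tau>\<^sup>2 = \<tau> + 1\<close>, the numbers \<open>r\<^sub>k = x\<^bsub>k+1\<^esub> - \<tau> x\<^sub>k\<close> satisfy \<open>r\<^bsub>k+1\<^esub> = (1 - \<tau>) r\<^sub>k + O(1)\<close> with \<open>\<bar>1 - \<tau>\<bar> < 1\<close>, so they
  are bounded.\<close>
lemma Q_order_golden_ratio:
  fixes s :: "nat \<Rightarrow> real"
  assumes lim: "s \<longlonglongrightarrow> L" and \<kappa>: "\<kappa> \<ge> 0"
    and K: "\<And>k. K k \<in> {\<kappa> / 2..2 * \<kappa>}"
    and rec: "\<And>k. s (k + 2) - L = (s (k + 1) - L) * (s k - L) * K k"
  shows "Q_order_at_least ((1 + sqrt 5) / 2) s L"
  unfolding Q_order_at_least_def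
proof
  define \<tau> :: real where "\<tau> = (1 + sqrt 5) / 2"
  define d where "d k = \<bar>s k - L\<bar>" for k
  have "2 < sqrt 5" "sqrt 5 < 3" by (auto intro: real_less_rsqrt real_less_lsqrt)
  then have \<tau>: "1 < \<tau>" "\<tau> < 2" "\<tau> * \<tau> = \<tau> + 1" by (auto simp: \<tau>_def field_simps)
  have d_rec: "d (k + 2) = d (k + 1) * d k * K k" for k
    using rec[of k] K[of k] \<kappa> by (simp add: d_def abs_mult)
  fix q :: real assume q: "q \<in> {1..<(1 + sqrt 5) / 2}"
  have "(\<lambda>k. d (Suc k) / d k powr q) \<longlonglongrightarrow> 0"
  proof (cases "\<exists>k. d k = 0")
    case True
    then obtain k where k: "d k = 0" by blast
    have z: "d (k + 2 + j) = 0" for j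
    proof (induction j)
      case 0
      then show ?case using d_rec[of k] k by simp
    next
      case (Suc j)
      then show ?case using d_rec[of "k + 1 + j"] by (simp add: add.commute add.left_commute)
    qed
    have "d (Suc j) / d j powr q = 0" if "j \<ge> k + 2" for j
      using z[of "j - (k + 1)"] that by simp
    then show ?thesis
      by (intro tendsto_eventually) (auto simp: eventually_sequentially)
  next
    case False
    then have d: "d k > 0" for k by (metis abs_ge_zero d_def le_less)
    have Kpos: "K k > 0" for k
      using d_rec[of k] d[of k] d[of "k + 1"] d[of "k + 2"] by (metis mult_pos_pos zero_less_mult_pos)
    with K[of 0] have \<kappa>: "\<kappa> > 0" using less_le_trans[of 0 "K 0" "2 * \<kappa>"] by auto
    define M where "M = max \<bar>ln (\<kappa> / 2)\<bar> \<bar>ln (2 * \<kappa>)\<bar>"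
    have M: "\<bar>ln (K k)\<bar> \<le> M" for k
    proof -
      have "ln (\<kappa> / 2) \<le> ln (K k)" "ln (K k) \<le> ln (2 * \<kappa>)"
        using K[of k] Kpos[of k] \<kappa> by auto
      then show ?thesis unfolding M_def by linarith
    qed
    define r where "r k = ln (d (k + 1)) - \<tau> * ln (d k)" for k
    have r: "r (k + 1) = (1 - \<tau>) * r k + ln (K k)" for k
    proof -
      have "ln (d (k + 2)) = ln (d (k + 1)) + ln (d k) + ln (K k)"
        unfolding d_rec using d[of k] d[of "k + 1"] Kpos[of k] by (simp add: ln_mult_pos)
      moreover have "\<tau> * (\<tau> * ln (d k)) = \<tau> * ln (d k) + ln (d k)"
        using \<tau>(3) by (metis distrib_right mult.assoc mult_1)
      ultimately show ?thesis by (simp add: r_def algebra_simps)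
    qed
    \<comment> \<open>A bound that is invariant under \<open>t \<mapsto> (\<tau> - 1) t + M\<close>.\<close>
    define B where "B = max \<bar>r 0\<bar> (M / (2 - \<tau>))"
    have B: "(\<tau> - 1) * B + M \<le> B"
    proof -
      have "M / (2 - \<tau>) \<le> B" by (simp add: B_def)
      then have "M \<le> B * (2 - \<tau>)" using \<tau>(2) by (simp add: divide_le_eq)
      then show ?thesis by (simp add: algebra_simps)
    qed
    have rB: "\<bar>r k\<bar> \<le> B" for k
    proof (induction k)
      case 0
      then show ?case by (simp add: B_def)
    next
      case (Suc k)
      have "\<bar>r (Suc k)\<bar> \<le> \<bar>(1 - \<tau>) * r k\<bar> + \<bar>ln (K k)\<bar>" using r[of k] by simp
      also have "\<dots> \<le> (\<tau> - 1) * B + M"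
        using Suc M[of k] \<tau>(1) by (intro add_mono) (auto simp: abs_mult intro!: mult_left_mono)
      finally show ?case using B by simp
    qed
    have upper: "\<forall>k. d (Suc k) / d k powr q \<le> exp B * d k powr (\<tau> - q)"
    proof
      fix k
      have "d (Suc k) / d k powr q = exp (ln (d (Suc k)) - q * ln (d k))"
        using d[of k] d[of "Suc k"] by (simp add: powr_def exp_diff)
      also have "ln (d (Suc k)) - q * ln (d k) = r k + (\<tau> - q) * ln (d k)"
        by (simp add: r_def algebra_simps)
      also have "exp \<dots> = exp (r k) * d k powr (\<tau> - q)"
        using d[of k] by (simp add: powr_def exp_add)
      also have "\<dots> \<le> exp B * d k powr (\<tau> - q)"
        using rB[of k] by (intro mult_right_mono) auto
      finally show "d (Suc k) / d k powr q \<le> exp B * d k powr (\<tau> - q)" .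
    qed
    have "(\<lambda>k. exp B * d k powr (\<tau> - q)) \<longlonglongrightarrow> exp B * 0"
    proof (intro tendsto_mult tendsto_const tendsto_zero_powrI)
      have "d \<longlonglongrightarrow> \<bar>L - L\<bar>" unfolding d_def by (intro tendsto_intros lim)
      then show "d \<longlonglongrightarrow> 0" by simp
      show "0 < \<tau> - q" using q by (simp add: \<tau>_def)
    qed (use d in \<open>auto simp: less_imp_le\<close>)
    then have zero: "(\<lambda>k. exp B * d k powr (\<tau> - q)) \<longlonglongrightarrow> 0" by simp
    show ?thesis
    proof (rule tendsto_sandwich[where f = "\<lambda>_. 0" and h = "\<lambda>k. exp B * d k powr (\<tau> - q)"])
      show "\<forall>\<^sub>F k in sequentially. 0 \<le> d (Suc k) / d k powr q"
        by (simp add: d_def)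
      show "\<forall>\<^sub>F k in sequentially. d (Suc k) / d k powr q \<le> exp B * d k powr (\<tau> - q)"
        using upper by (rule always_eventually)
    qed (rule tendsto_const, rule zero)
  qed
  then show "(\<lambda>k. \<bar>s (Suc k) - L\<bar> / \<bar>s k - L\<bar> powr q) \<longlonglongrightarrow> 0" by (simp add: d_def)
qed

text \<open>The radius keeps the iterates positive and inside the region where \<open>f\<close> has the stated form, and makes
  \<open>2 \<kappa> \<delta> \<le> 1/2\<close>, so that from \<open>s 1\<close> on each error is at most half of its predecessor. In particular, successive iterates can
  coincide only at \<open>L\<close>.\<close>
lemma secant_seq_sqrt_quadratic:
  fixes f :: "real \<Rightarrow> real"
  assumes a: "a \<ge> 0" and c: "c > 0" and L: "L > 0" and \<epsilon>: "\<epsilon> > 0"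
    and f: "\<And>z. \<bar>z - L\<bar> < \<epsilon> \<Longrightarrow> f z = sqrt (a + c * z\<^sup>2)"
  shows "\<exists>\<delta>>0. \<forall>l'\<in>ball L \<delta>. \<forall>l\<in>ball L \<delta>. l' \<noteq> l \<longrightarrow>
           (let s = secant_seq f (f L) l' l in
              secant_well_defined f (f L) s \<and> s \<longlonglongrightarrow> L \<and> Q_superlinear s L \<and>
              Q_order_at_least ((1 + sqrt 5) / 2) s L)"
proof -
  define g where "g z = sqrt (a + c * z\<^sup>2)" for z
  obtain \<kappa> \<delta>0 where \<kappa>: "\<kappa> \<ge> 0" and \<delta>0: "\<delta>0 > 0"
    and K0: "\<And>u v. \<bar>u - L\<bar> < \<delta>0 \<Longrightarrow> \<bar>v - L\<bar> < \<delta>0 \<Longrightarrow> secant_factor g c L u v \<in> {\<kappa> / 2..2 * \<kappa>}"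
    using secant_factor_bounds[OF g_def a c L] by blast
  define \<delta> where "\<delta> = Min {\<delta>0, \<epsilon>, L, 1 / (4 * (\<kappa> + 1))}"
  have \<delta>: "\<delta> > 0" "\<delta> \<le> \<delta>0" "\<delta> \<le> \<epsilon>" "\<delta> \<le> L" "\<delta> \<le> 1 / (4 * (\<kappa> + 1))"
    using \<delta>0 \<epsilon> L \<kappa> by (auto simp: \<delta>_def)
  have \<kappa>\<delta>: "2 * \<kappa> * \<delta> \<le> 1 / 2"
  proof -
    have "4 * (\<kappa> + 1) * \<delta> \<le> 1" using \<delta>(5) \<kappa> by (simp add: field_simps)
    then show ?thesis using \<delta>(1) by (simp add: algebra_simps)
  qed
  have f: "f z = g z" "z > 0" if "\<bar>z - L\<bar> < \<delta>" for z
    using that f[of z] \<delta> by (auto simp: g_def)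
  have fL: "f L = g L" using f[of L] \<delta>(1) by simp
  have inj: "u = v" if "\<bar>u - L\<bar> < \<delta>" "\<bar>v - L\<bar> < \<delta>" "f u = f v" for u v
  proof -
    have "sqrt (a + c * u\<^sup>2) = sqrt (a + c * v\<^sup>2)"
      using that(3) unfolding f(1)[OF that(1)] f(1)[OF that(2)] g_def .
    then have "u\<^sup>2 = v\<^sup>2" using c by simp
    then show ?thesis
      by (rule power2_eq_imp_eq) (rule less_imp_le, rule f(2), rule that)+
  qed
  have fix_L: "v = L" if "\<bar>v - L\<bar> < \<delta>" "f v = f L" for v
    using inj[of v L] that \<delta>(1) by simp
  have "secant_well_defined f (f L) s \<and> s \<longlonglongrightarrow> L \<and> Q_superlinear s L \<and>
      Q_order_at_least ((1 + sqrt 5) / 2) s L"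
    if l: "l' \<in> ball L \<delta>" "l \<in> ball L \<delta>" "l' \<noteq> l" and s_def: "s = secant_seq f (f L) l' l" for l l' s
  proof -
    have step: "\<exists>K\<in>{\<kappa> / 2..2 * \<kappa>}. s (k + 2) - L = (s (k + 1) - L) * (s k - L) * K"
      if "\<bar>s k - L\<bar> < \<delta>" "\<bar>s (k + 1) - L\<bar> < \<delta>" "s (k + 1) \<noteq> s k \<or> s (k + 1) = L" for k
    proof (cases "f (s (k + 1)) = f L")
      case True
      \<comment> \<open>Once the method has stopped, both sides of the recursion vanish and any factor will do.\<close>
      with fix_L[OF that(2)] have "s (k + 1) = L" "s (k + 2) = L"
        by (simp_all add: s_def Let_def)
      then show ?thesis using \<kappa> by (intro bexI[of _ \<kappa>]) auto
    next
      case False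
      then have "s (k + 1) \<noteq> L" by auto
      with that(3) have ne: "s k \<noteq> s (k + 1)" by auto
      have "s (k + 2) = s (k + 1) - inverse ((f (s (k + 1)) - f (s k)) / (s (k + 1) - s k)) * (f (s (k + 1)) - f L)"
        using False by (simp add: s_def Let_def)
      then have "s (k + 2) - L = (s (k + 1) - L) * (s k - L) * secant_factor g c L (s k) (s (k + 1))"
        using secant_step_sqrt_quadratic[OF g_def a c f(2)[OF that(1)] f(2)[OF that(2)] L ne]
        unfolding f(1)[OF that(1)] f(1)[OF that(2)] fL by simp
      moreover have "secant_factor g c L (s k) (s (k + 1)) \<in> {\<kappa> / 2..2 * \<kappa>}"
        using that(1,2) \<delta>(2) by (intro K0) auto
      ultimately show ?thesis by blast
    qed
    have contr: "\<bar>s (k + 2) - L\<bar> \<le> 1 / 2 * \<bar>s (k + 1) - L\<bar>"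
      if near: "\<bar>s k - L\<bar> < \<delta>" "\<bar>s (k + 1) - L\<bar> < \<delta>" "s (k + 1) \<noteq> s k \<or> s (k + 1) = L" for k
    proof -
      obtain K where K: "K \<in> {\<kappa> / 2..2 * \<kappa>}" "s (k + 2) - L = (s (k + 1) - L) * (s k - L) * K"
        using step[OF near] by blast
      have "\<bar>s k - L\<bar> * K \<le> \<delta> * (2 * \<kappa>)"
        using K(1) near(1) \<kappa> \<delta>(1) by (intro mult_mono) auto
      also have "\<dots> \<le> 1 / 2" using \<kappa>\<delta> by (simp add: mult.commute)
      finally have "\<bar>s (k + 1) - L\<bar> * (\<bar>s k - L\<bar> * K) \<le> \<bar>s (k + 1) - L\<bar> * (1 / 2)"
        by (intro mult_left_mono) auto
      then show ?thesis using K \<kappa> by (simp add: abs_mult mult.assoc)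
    qed
    have inv: "\<bar>s k - L\<bar> < \<delta> \<and> \<bar>s (k + 1) - L\<bar> < \<delta> \<and> (s (k + 1) \<noteq> s k \<or> s (k + 1) = L)" for k
    proof (induction k)
      case 0
      then show ?case using l by (auto simp: s_def dist_real_def abs_minus_commute)
    next
      case (Suc k)
      then have half: "\<bar>s (k + 2) - L\<bar> \<le> 1 / 2 * \<bar>s (k + 1) - L\<bar>" by (intro contr) auto
      also have "\<dots> \<le> 1 * \<bar>s (k + 1) - L\<bar>" by (rule mult_right_mono) auto
      also have "\<dots> < \<delta>" using Suc by simp
      finally have "\<bar>s (k + 2) - L\<bar> < \<delta>" .
      moreover have "s (k + 2) = L" if "s (k + 2) = s (k + 1)" using half that by auto
      ultimately show ?case using Suc by auto
    qed
    obtain K where K: "\<And>k. K k \<in> {\<kappa> / 2..2 * \<kappa>}"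
      and rec: "\<And>k. s (k + 2) - L = (s (k + 1) - L) * (s k - L) * K k"
      using step inv by metis
    have wd: "secant_well_defined f (f L) s"
      unfolding secant_well_defined_def
    proof (intro conjI allI impI)
      fix k
      show "0 < s k" using inv f(2) by blast
      assume "f (s (Suc k)) \<noteq> f L"
      then show "s (Suc k) \<noteq> s k" using inv[of k] by auto
      then show "f (s (Suc k)) \<noteq> f (s k)" using inj inv[of k] by auto
    qed
    have geo: "\<bar>s (k + 1) - L\<bar> \<le> \<delta> * (1 / 2) ^ k" for k
    proof (induction k)
      case 0
      then show ?case using inv[of 0] by auto
    next
      case (Suc k)
      with contr[of k] inv[of k] show ?case by auto
    qed
    have lim: "s \<longlonglongrightarrow> L"
    proof (rule LIMSEQ_imp_Suc, rule LIM_zero_cancel, rule Lim_null_comparison)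
      show "\<forall>\<^sub>F k in sequentially. norm (s (Suc k) - L) \<le> \<delta> * (1 / 2) ^ k" using geo by simp
      have "(\<lambda>k. \<delta> * (1 / 2) ^ k) \<longlonglongrightarrow> \<delta> * 0"
        by (intro tendsto_mult tendsto_const LIMSEQ_realpow_zero) auto
      then show "(\<lambda>k. \<delta> * (1 / 2) ^ k) \<longlonglongrightarrow> 0" by simp
    qed
    have "\<bar>s (k + 2) - L\<bar> \<le> 2 * \<kappa> * \<bar>s k - L\<bar> * \<bar>s (k + 1) - L\<bar>" for k
    proof -
      have "\<bar>s (k + 2) - L\<bar> = K k * (\<bar>s k - L\<bar> * \<bar>s (k + 1) - L\<bar>)"
        using K[of k] \<kappa> by (simp only: rec abs_mult) auto
      also have "\<dots> \<le> 2 * \<kappa> * (\<bar>s k - L\<bar> * \<bar>s (k + 1) - L\<bar>)"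
        using K[of k] by (intro mult_right_mono) auto
      finally show ?thesis by (simp add: mult.assoc)
    qed
    from Q_superlinear_of_product_recursion[OF lim this] wd lim Q_order_golden_ratio[OF lim \<kappa> K rec]
    show ?thesis by blast
  qed
  then show ?thesis using \<delta>(1) unfolding Let_def by blast
qed

section \<open>Convergence of the secant method\<close>

theorem proposition5p3:
  fixes A :: "real^'n^'m" and b :: "real^'m" and p :: "real^'n \<Rightarrow> ereal"
    and \<rho> lstar :: real
  assumes rho: "0 < \<rho>" "\<rho> < norm b"
    and gauge: "gauge_fun p"
    and proper: "proper_fun p"
    and closed: "closed_fun p"
    and polyhedral: "polyhedral_fun p"
    and active: "\<exists>x. is_arg_min p (\<lambda>x. norm (A *v x - b) \<le> \<rho>) x \<and> norm (A *v x - b) = \<rho>"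
    and kkt: "\<forall>l>0. \<exists>y u x. x \<in> subdifferential (conjugate p) u \<and>
                y - b + A *v x = 0 \<and> transpose A *v y - l *\<^sub>R u = 0"
    and lstar: "0 < lstar" "phi A b p lstar = \<rho>"
    and lambda_inf: "0 < lambda_inf A b p" "lambda_inf A b p < \<infinity>"
    and clarke: "is_singleton (clarke_jacobian (phi A b p) lstar)"
  shows "\<exists>\<delta>>0. \<forall>l'\<in>ball lstar \<delta>. \<forall>l\<in>ball lstar \<delta>. l' \<noteq> l \<longrightarrow>
           (let s = secant_seq (phi A b p) \<rho> l' l in
              secant_well_defined (phi A b p) \<rho> s \<and>
              s \<longlonglongrightarrow> lstar \<and>
              Q_superlinear s lstar \<and>
              Q_order_at_least ((1 + sqrt 5) / 2) s lstar)"
proof -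
  have K: "\<exists>x u. kkt_pair A b p l x u" if "l > 0" for l
    using kkt that kkt_pair_of_conjugate[OF gauge closed] by blast
  obtain \<epsilon> a c where "\<epsilon> > 0" "a \<ge> 0" "c > 0"
    "\<And>z. \<bar>z - lstar\<bar> < \<epsilon> \<Longrightarrow> phi A b p z = sqrt (a + c * z\<^sup>2)"
    using phi_local_form[OF gauge polyhedral K lstar(1) lambda_inf(2) _ _ clarke] rho lstar(2) by blast
  from secant_seq_sqrt_quadratic[OF this(2,3) lstar(1) this(1,4)]
  show ?thesis unfolding lstar(2) .
qed

end
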